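(* There exist finitely generated virtually abelian groups $G$ such that, for every finite symmetric generating set $A$ of $G$, the geodesic language $\mathsf{Geo}(G,A)$ is not piecewise excluding.
   Context: A generating set $A$ of a group $G$ is symmetric if it is inverse-closed: $A$ is a subset of $G$ generating $G$ and $a\in A$ implies $a^{-1}\in A$ (the identity element is allowed to belong to $A$). $A^*$ denotes the set of all finite words over the alphabet $A$, including the empty word. A word $w\in A^*$ is geodesic if it labels a path of minimal length between two vertices of the Cayley graph of $G$ over $A$; equivalently, no strictly shorter word over $A$ represents the same element of $G$ as $w$. The geodesic language $\mathsf{Geo}(G,A)\subseteq A^*$ is the set of all geodesic words. A word $a_1a_2\cdots a_n$ ($a_i\in A$) is a piecewise subword of $w\in A^*$ if $w=w_0a_1w_1a_2\cdots a_nw_n$ for some $w_i\in A^*$ (i.e. it is a not necessarily contiguous subsequence of $w$). A language $L\subseteq A^*$ is piecewise excluding if there is a finite set $F\subset A^*$ such that, for all $w\in A^*$, $w\in L$ if and only if $w$ contains no piecewise subword in $F$. *)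

theory Defs
  imports "HOL-Algebra.Generated_Groups" "HOL-Library.Sublist"
begin

definition finitely_generated_group :: "('a, 'b) monoid_scheme \<Rightarrow> bool" where
  "finitely_generated_group G \<longleftrightarrow>
     group G \<and> (\<exists>S. finite S \<and> S \<subseteq> carrier G \<and> generate G S = carrier G)"

definition virtually_abelian :: "('a, 'b) monoid_scheme \<Rightarrow> bool" where
  "virtually_abelian G \<longleftrightarrow>
     group G \<and>
     (\<exists>H. subgroup H G \<and> comm_group (G\<lparr>carrier := H\<rparr>) \<and> finite (rcosets\<^bsub>G\<^esub> H))"

definition symmetric_generating_set :: "('a, 'b) monoid_scheme \<Rightarrow> 'a set \<Rightarrow> bool" where
  "symmetric_generating_set G A \<longleftrightarrow>
     A \<subseteq> carrier G \<and> generate G A = carrier G \<and> (\<forall>a\<in>A. inv\<^bsub>G\<^esub> a \<in> A)"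

text \<open>
  Words over \<open>A\<close> are lists, so that the set of all words is \<^term>\<open>lists A\<close>. The Cayley
  graph has vertex set \<^term>\<open>carrier G\<close> and an edge labelled \<open>a\<close> from \<open>g\<close> to
  \<open>g \<otimes> a\<close> for each \<open>a \<in> A\<close>; \<open>cayley_path G A g w h\<close> says that \<open>w\<close> labels a path
  from \<open>g\<close> to \<open>h\<close>.
\<close>

inductive cayley_path ::
    "('a, 'b) monoid_scheme \<Rightarrow> 'a set \<Rightarrow> 'a \<Rightarrow> 'a list \<Rightarrow> 'a \<Rightarrow> bool"
  for G (structure) and A where
  Nil: "g \<in> carrier G \<Longrightarrow> cayley_path G A g [] g"
| Cons: "\<lbrakk>g \<in> carrier G; a \<in> A; cayley_path G A (g \<otimes> a) w h\<rbrakk>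
           \<Longrightarrow> cayley_path G A g (a # w) h"

definition geodesic_word :: "('a, 'b) monoid_scheme \<Rightarrow> 'a set \<Rightarrow> 'a list \<Rightarrow> bool" where
  "geodesic_word G A w \<longleftrightarrow>
     (\<exists>g h. cayley_path G A g w h \<and> (\<forall>v. cayley_path G A g v h \<longrightarrow> length w \<le> length v))"

definition Geo :: "('a, 'b) monoid_scheme \<Rightarrow> 'a set \<Rightarrow> 'a list set" where
  "Geo G A = {w \<in> lists A. geodesic_word G A w}"

text \<open>
  \<^term>\<open>subseq u w\<close> is the piecewise subword relation: \<open>u\<close> is a not necessarily contiguous
  subsequence of \<open>w\<close>.
\<close>

definition piecewise_excluding :: "'a set \<Rightarrow> 'a list set \<Rightarrow> bool" where
  "piecewise_excluding A L \<longleftrightarrow>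
     (\<exists>F. finite F \<and> F \<subseteq> lists A \<and>
        (\<forall>w\<in>lists A. w \<in> L \<longleftrightarrow> \<not> (\<exists>u\<in>F. subseq u w)))"

abbreviation word_value :: "('a, 'b) monoid_scheme \<Rightarrow> 'a list \<Rightarrow> 'a" where
  "word_value G w \<equiv> foldr (mult G) w (one G)"

lemma (in group) word_value_closed:
  "A \<subseteq> carrier G \<Longrightarrow> w \<in> lists A \<Longrightarrow> word_value G w \<in> carrier G"
  by (induction w) auto

lemma (in group) cayley_path_iff:
  assumes "A \<subseteq> carrier G"
  shows "cayley_path G A g w h \<longleftrightarrow>
           g \<in> carrier G \<and> w \<in> lists A \<and> h = g \<otimes> word_value G w"
proof (induction w arbitrary: g)
  case Nil
  show ?case
    by (auto elim: cayley_path.cases intro: cayley_path.Nil)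
next
  case (Cons a w)
  have "cayley_path G A g (a # w) h \<longleftrightarrow>
          g \<in> carrier G \<and> a \<in> A \<and> cayley_path G A (g \<otimes> a) w h"
    by (auto elim: cayley_path.cases intro: cayley_path.Cons)
  also have "\<dots> \<longleftrightarrow> g \<in> carrier G \<and> a # w \<in> lists A \<and> h = g \<otimes> word_value G (a # w)"
    unfolding Cons.IH using assms word_value_closed[OF assms, of w]
    by (auto simp: m_assoc subset_iff simp flip: in_lists_conv_set)
  finally show ?case .
qed

lemma (in group) geodesic_word_iff:
  assumes "A \<subseteq> carrier G"
  shows "geodesic_word G A w \<longleftrightarrow>
           w \<in> lists A \<and>
           (\<forall>v\<in>lists A. word_value G v = word_value G w \<longrightarrow> length w \<le> length v)"
proof -
  have "g \<otimes> word_value G w = g \<otimes> word_value G v \<longleftrightarrow> word_value G v = word_value G w"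
    if "g \<in> carrier G" "v \<in> lists A" "w \<in> lists A" for g v
    using that word_value_closed[OF assms] by auto
  then show ?thesis
    unfolding geodesic_word_def cayley_path_iff[OF assms] by (metis one_closed)
qed

end

theory Submission
  imports Defs "HOL-Library.Nat_Bijection"
begin

text \<open>
  A piecewise excluding language is closed under piecewise subwords, so it is enough to find, for
  every finite symmetric generating set of the infinite dihedral group, a geodesic with a
  non-geodesic piecewise subword. Let the translations in the generating set move points by at most
  \<open>\<tau>\<close>, and let the reflections in it have parameters between \<open>m\<close> and \<open>M\<close>, both attained. A word of
  length \<open>n\<close> moves points by at most about \<open>c n / 2\<close>, where \<open>c = max (2 \<tau>) (M - m)\<close>.
  If \<open>c = 2 \<tau>\<close>, the word \<open>t r t\<inverse>\<close> attains this bound for \<open>t\<close> the longest translation and \<open>r\<close> the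
  reflection with parameter \<open>M\<close>; if \<open>c = M - m\<close>, the word \<open>r s r\<close> does so for \<open>r\<close> and \<open>s\<close> the
  reflections with parameters \<open>M\<close> and \<open>m\<close>. Deleting the middle letter leaves the identity.
\<close>

text \<open>By transitivity, a forbidden piecewise subword of \<open>u\<close> would also occur in
  \<open>w\<close>.\<close>

lemma piecewise_excluding_subseq_closed:
  assumes "piecewise_excluding A L" "w \<in> L" "w \<in> lists A" "subseq u w"
  shows "u \<in> L"
proof -
  obtain F where F: "\<forall>w\<in>lists A. w \<in> L \<longleftrightarrow> \<not> (\<exists>u\<in>F. subseq u w)"
    using assms(1) unfolding piecewise_excluding_def by (elim exE conjE)
  have "set u \<subseteq> set w"
    using assms(4) by (auto elim: list_emb_set)
  then have "u \<in> lists A"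
    using assms(3) by auto
  moreover have "\<not> subseq v u" if "v \<in> F" for v
    using F assms(2-4) that subseq_order.trans[of v u w] by blast
  ultimately show ?thesis
    using F by blast
qed

section \<open>The infinite dihedral group and its virtual commutativity\<close>

text \<open>
  The integer \<open>x\<close> stands for the isometry \<open>z \<mapsto> x + (-1)\<^sup>x z\<close> of the line: a translation if \<open>x\<close> is
  even, a reflection if \<open>x\<close> is odd. These isometries compose to the following multiplication.
\<close>

definition dihedral_mult :: "int \<Rightarrow> int \<Rightarrow> int" where
  "dihedral_mult x y = (if even x then x + y else x - y)"

definition infinite_dihedral :: "nat monoid" where
  "infinite_dihedral =
     \<lparr>carrier = UNIV,
      mult = \<lambda>x y. int_encode (dihedral_mult (int_decode x) (int_decode y)),
      one = int_encode 0\<rparr>"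

lemma carrier_infinite_dihedral [simp]: "carrier infinite_dihedral = UNIV"
  by (simp add: infinite_dihedral_def)

lemma decode_mult [simp]:
  "int_decode (x \<otimes>\<^bsub>infinite_dihedral\<^esub> y) = dihedral_mult (int_decode x) (int_decode y)"
  by (simp add: infinite_dihedral_def)

lemma decode_one [simp]: "int_decode \<one>\<^bsub>infinite_dihedral\<^esub> = 0"
  by (simp add: infinite_dihedral_def)

lemma decode_eq_iff: "x = y \<longleftrightarrow> int_decode x = int_decode y"
  using inj_int_decode[of UNIV] by (auto dest: injD)

lemma group_infinite_dihedral: "group infinite_dihedral"
proof (rule groupI)
  fix x
  \<comment> \<open>Translations are inverted by negation, while reflections are
    involutions.\<close>
  let ?i = "if even (int_decode x) then - int_decode x else int_decode x"
  have "int_encode ?i \<otimes>\<^bsub>infinite_dihedral\<^esub> x = \<one>\<^bsub>infinite_dihedral\<^esub>"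
    by (simp add: decode_eq_iff dihedral_mult_def)
  then show "\<exists>y\<in>carrier infinite_dihedral. y \<otimes>\<^bsub>infinite_dihedral\<^esub> x = \<one>\<^bsub>infinite_dihedral\<^esub>"
    by auto
qed (auto simp: decode_eq_iff dihedral_mult_def)

interpretation dihedral: group infinite_dihedral
  by (rule group_infinite_dihedral)

lemma decode_inv [simp]:
  "int_decode (inv\<^bsub>infinite_dihedral\<^esub> x) =
     (if even (int_decode x) then - int_decode x else int_decode x)"
proof -
  have "dihedral_mult (int_decode (inv\<^bsub>infinite_dihedral\<^esub> x)) (int_decode x) = 0"
    using dihedral.l_inv[of x] decode_mult decode_one by (metis UNIV_I carrier_infinite_dihedral)
  then show ?thesis
    unfolding dihedral_mult_def by presburger
qed

lemma finitely_generated_infinite_dihedral: "finitely_generated_group infinite_dihedral"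
proof -
  let ?S = "{int_encode 1, int_encode 2}"
  let ?H = "generate infinite_dihedral ?S"
  have H: "subgroup ?H infinite_dihedral"
    by (rule dihedral.generate_is_subgroup) simp
  have mult: "int_encode (dihedral_mult x y) \<in> ?H" if "int_encode x \<in> ?H" "int_encode y \<in> ?H" for x y
    using subgroup.m_closed[OF H that] by (simp add: infinite_dihedral_def)
  have one: "int_encode 1 \<in> ?H" and two: "int_encode 2 \<in> ?H"
    by (auto intro: generate.incl)
  have "inv\<^bsub>infinite_dihedral\<^esub> (int_encode 2) = int_encode (- 2)"
    by (simp add: decode_eq_iff)
  then have minus_two: "int_encode (- 2) \<in> ?H"
    using subgroup.m_inv_closed[OF H two] by simp
  \<comment> \<open>Powers of the translation 2 in both directions give every even integer; the
    product of 2k with the reflection 1 then gives 2k + 1.\<close>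
  have even: "int_encode (2 * k) \<in> ?H" for k
  proof (induction k rule: int_induct[where k = 0])
    case base
    then show ?case
      using subgroup.one_closed[OF H] by (simp add: infinite_dihedral_def)
  next
    case (step1 i)
    then show ?case
      using mult[OF two step1(2)] by (simp add: dihedral_mult_def distrib_left add.commute)
  next
    case (step2 i)
    then show ?case
      using mult[OF minus_two step2(2)] by (simp add: dihedral_mult_def right_diff_distrib)
  qed
  have "int_encode n \<in> ?H" for n
  proof (cases "even n")
    case True
    then show ?thesis
      using even by (auto elim: evenE)
  next
    case False
    then obtain k where "n = 2 * k + 1"
      by (rule oddE)
    then show ?thesis
      using mult[OF even one, of k] by (simp add: dihedral_mult_def)
  qed
  then have "?H = UNIV"
    by (metis UNIV_eq_I int_decode_inverse)
  then have "finite ?S \<and> ?S \<subseteq> carrier infinite_dihedral \<and> ?H = carrier infinite_dihedral"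
    by simp
  then show ?thesis
    unfolding finitely_generated_group_def using group_infinite_dihedral by blast
qed

lemma subgroup_translations: "subgroup {x. even (int_decode x)} infinite_dihedral"
proof (rule dihedral.subgroupI)
  have "int_encode 0 \<in> {x. even (int_decode x)}"
    by simp
  then show "{x. even (int_decode x)} \<noteq> {}"
    by blast
qed (simp_all add: dihedral_mult_def)

lemma virtually_abelian_infinite_dihedral: "virtually_abelian infinite_dihedral"
proof -
  let ?H = "{x. even (int_decode x)}"
  have "comm_group (infinite_dihedral\<lparr>carrier := ?H\<rparr>)"
    using subgroup.subgroup_is_group[OF subgroup_translations group_infinite_dihedral]
    by (rule group.group_comm_groupI) (auto simp: decode_eq_iff dihedral_mult_def)
  \<comment> \<open>A coset of the translations is determined by a parity, so there are at most
    two.\<close>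
  moreover have "?H #>\<^bsub>infinite_dihedral\<^esub> x = {y. even (int_decode y) = even (int_decode x)}" for x
  proof (intro equalityI subsetI)
    fix y
    assume "y \<in> ?H #>\<^bsub>infinite_dihedral\<^esub> x"
    then obtain h where "even (int_decode h)" "y = h \<otimes>\<^bsub>infinite_dihedral\<^esub> x"
      unfolding r_coset_def by blast
    then show "y \<in> {y. even (int_decode y) = even (int_decode x)}"
      by (simp add: dihedral_mult_def)
  next
    fix y
    let ?h = "int_encode (int_decode y - int_decode x)"
    assume "y \<in> {y. even (int_decode y) = even (int_decode x)}"
    then have "?h \<in> ?H" "y = ?h \<otimes>\<^bsub>infinite_dihedral\<^esub> x"
      by (simp_all add: decode_eq_iff dihedral_mult_def)
    then show "y \<in> ?H #>\<^bsub>infinite_dihedral\<^esub> x"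
      unfolding r_coset_def by blast
  qed
  then have "rcosets\<^bsub>infinite_dihedral\<^esub> ?H \<subseteq> range (\<lambda>b. {y. even (int_decode y) = b})"
    unfolding RCOSETS_def by auto
  then have "finite (rcosets\<^bsub>infinite_dihedral\<^esub> ?H)"
    by (rule finite_subset) simp
  ultimately show ?thesis
    unfolding virtually_abelian_def using group_infinite_dihedral subgroup_translations by blast
qed

section \<open>How far a word of given length can reach\<close>

text \<open>Each letter contributes at most c/2, except that in an odd value one reflection
  contributes its own parameter, hence the length minus one. All is doubled to avoid halving
  \<open>c\<close>. Two odd factors multiply to a difference, so the induction needs both the upper
  and the lower bound, and M - m \<le> c absorbs the two parameters.\<close>

lemma word_value_bounds:
  fixes c M m :: int
  assumes "w \<in> lists A"
    and translation: "\<And>a. a \<in> A \<Longrightarrow> even (int_decode a) \<Longrightarrow> 2 * \<bar>int_decode a\<bar> \<le> c"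
    and reflection: "\<And>a. a \<in> A \<Longrightarrow> odd (int_decode a) \<Longrightarrow> int_decode a \<in> {m..M}"
    and "M - m \<le> c"
  shows "if even (int_decode (word_value infinite_dihedral w))
         then 2 * \<bar>int_decode (word_value infinite_dihedral w)\<bar> \<le> c * int (length w)
         else 2 * int_decode (word_value infinite_dihedral w) \<le> 2 * M + c * (int (length w) - 1) \<and>
              2 * int_decode (word_value infinite_dihedral w) \<ge> 2 * m - c * (int (length w) - 1)"
  using assms(1)
proof (induction w)
  case Nil
  then show ?case by simp
next
  case (Cons a w)
  then have a: "a \<in> A" by simp
  define x where "x = int_decode a"
  define y where "y = int_decode (word_value infinite_dihedral w)"
  define L where "L = c * int (length w)"
  have "if even y then 2 * \<bar>y\<bar> \<le> L else 2 * y \<le> 2 * M + (L - c) \<and> 2 * y \<ge> 2 * m - (L - c)"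
    using Cons.IH Cons.prems unfolding y_def L_def by (simp add: right_diff_distrib split: if_splits)
  moreover have "if even x then 2 * \<bar>x\<bar> \<le> c else m \<le> x \<and> x \<le> M"
    using translation[OF a] reflection[OF a] by (simp add: x_def)
  ultimately have "if even (dihedral_mult x y) then 2 * \<bar>dihedral_mult x y\<bar> \<le> L + c
      else 2 * dihedral_mult x y \<le> 2 * M + L \<and> 2 * dihedral_mult x y \<ge> 2 * m - L"
    using \<open>M - m \<le> c\<close>
    by (cases "even x"; cases "even y") (auto simp: dihedral_mult_def abs_if split: if_splits)
  moreover have "int_decode (word_value infinite_dihedral (a # w)) = dihedral_mult x y"
    by (simp add: x_def y_def)
  moreover have "c * int (length (a # w)) = L + c" "c * (int (length (a # w)) - 1) = L"
    by (simp_all add: L_def algebra_simps)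
  ultimately show ?case
    by metis
qed

section \<open>Geodesics whose middle letter separates an inverse pair\<close>

text \<open>Here \<open>min\<close> makes \<open>[x, r, y]\<close> geodesic, while its subword
  \<open>[x, y]\<close> is not, since the empty word also represents the identity.\<close>

lemma not_piecewise_excluding_if_cancelling:
  assumes A: "A \<subseteq> carrier infinite_dihedral"
    and "[x, r, y] \<in> lists A"
    and "x \<otimes>\<^bsub>infinite_dihedral\<^esub> y = \<one>\<^bsub>infinite_dihedral\<^esub>"
    and min: "\<And>v. v \<in> lists A \<Longrightarrow>
           word_value infinite_dihedral v = word_value infinite_dihedral [x, r, y] \<Longrightarrow> 3 \<le> length v"
  shows "\<not> piecewise_excluding A (Geo infinite_dihedral A)"
proof
  assume "piecewise_excluding A (Geo infinite_dihedral A)"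
  moreover have "[x, r, y] \<in> Geo infinite_dihedral A"
    using assms(2) min
    by (simp add: Geo_def dihedral.geodesic_word_iff[OF A] numeral_3_eq_3 del: foldr.simps)
  moreover have "subseq [x, y] [x, r, y]"
    by simp
  ultimately have "[x, y] \<in> Geo infinite_dihedral A"
    using piecewise_excluding_subseq_closed assms(2) by blast
  then have "\<forall>v\<in>lists A. word_value infinite_dihedral v = word_value infinite_dihedral [x, y] \<longrightarrow>
      length [x, y] \<le> length v"
    by (simp add: Geo_def dihedral.geodesic_word_iff[OF A] del: foldr.simps)
  moreover have "word_value infinite_dihedral [] = word_value infinite_dihedral [x, y]"
    using assms(3) by simp
  ultimately have "length [x, y] \<le> length ([] :: nat list)"
    by blast
  then show False
    by simp
qed

lemma Geo_infinite_dihedral_not_piecewise_excluding: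
  assumes "finite A" and sym: "symmetric_generating_set infinite_dihedral A"
  shows "\<not> piecewise_excluding A (Geo infinite_dihedral A)"
proof -
  have A: "A \<subseteq> carrier infinite_dihedral"
    and gen: "generate infinite_dihedral A = UNIV"
    and inv: "\<And>a. a \<in> A \<Longrightarrow> inv\<^bsub>infinite_dihedral\<^esub> a \<in> A"
    using sym by (auto simp: symmetric_generating_set_def)
  have proper: "H = UNIV" if "subgroup H infinite_dihedral" "A \<subseteq> H" for H
    using dihedral.generate_subgroup_incl[OF that(2,1)] gen by auto
  define R where "R = int_decode ` {a \<in> A. odd (int_decode a)}"
  \<comment> \<open>The inserted 0 makes \<open>Max T\<close> meaningful even if \<open>A\<close>
    contains no translation.\<close>
  define T where "T = insert 0 (int_decode ` {a \<in> A. even (int_decode a)})"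
  \<comment> \<open>The translations form a proper subgroup, so \<open>A\<close> must contain a
    reflection.\<close>
  have "\<not> A \<subseteq> {x. even (int_decode x)}"
  proof
    assume "A \<subseteq> {x. even (int_decode x)}"
    then have "int_encode 1 \<in> {x. even (int_decode x)}"
      using proper[OF subgroup_translations] by blast
    then show False
      by simp
  qed
  then have R: "finite R" "R \<noteq> {}"
    using \<open>finite A\<close> by (auto simp: R_def)
  have T: "finite T" "T \<noteq> {}"
    using \<open>finite A\<close> by (auto simp: T_def)
  define M where "M = Max R"
  define m where "m = Min R"
  define \<tau> where "\<tau> = Max T"
  define c where "c = max (2 * \<tau>) (M - m)"
  have "M \<in> R" "m \<in> R" "\<tau> \<in> T"
    using R T by (simp_all add: M_def m_def \<tau>_def)
  then obtain r s where r: "r \<in> A" "int_decode r = M" "odd M"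
    and s: "s \<in> A" "int_decode s = m" "odd m"
    by (auto simp: R_def)
  have "\<tau> \<ge> 0"
    unfolding \<tau>_def using T by (simp add: T_def)
  have "m \<le> M"
    using \<open>m \<in> R\<close> R by (simp add: M_def)
  have reflection: "int_decode a \<in> {m..M}" if "a \<in> A" "odd (int_decode a)" for a
    using that R by (auto simp: M_def m_def R_def)
  have le_\<tau>: "int_decode a \<le> \<tau>" if "a \<in> A" "even (int_decode a)" for a
    using that T(1) unfolding \<tau>_def by (auto simp: T_def intro!: Max_ge)
  \<comment> \<open>Inverting a translation negates it, so symmetry of \<open>A\<close> bounds both
    signs.\<close>
  have abs_le_\<tau>: "\<bar>int_decode a\<bar> \<le> \<tau>" if "a \<in> A" "even (int_decode a)" for a
    using le_\<tau>[OF that] le_\<tau>[OF inv[OF that(1)]] that by auto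
  \<comment> \<open>Otherwise \<open>A\<close> would lie in a subgroup of order two, but the group
    is infinite.\<close>
  have c: "c > 0"
  proof (rule ccontr)
    assume "\<not> c > 0"
    then have "\<tau> = 0" "m = M"
      using \<open>\<tau> \<ge> 0\<close> \<open>m \<le> M\<close> by (auto simp: c_def)
    have "A \<subseteq> {int_encode 0, int_encode M}"
    proof
      fix a
      assume "a \<in> A"
      then have "int_decode a = 0 \<or> int_decode a = M"
        using abs_le_\<tau>[of a] reflection[of a] \<open>\<tau> = 0\<close> \<open>m = M\<close> by (cases "even (int_decode a)") auto
      then show "a \<in> {int_encode 0, int_encode M}"
        by (simp add: decode_eq_iff)
    qed
    moreover have "subgroup {int_encode 0, int_encode M} infinite_dihedral"
      using \<open>odd M\<close> by (intro dihedral.subgroupI) (auto simp: dihedral_mult_def decode_eq_iff)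
    ultimately have "UNIV = {int_encode 0, int_encode M}"
      using proper by blast
    then have "finite (UNIV :: nat set)"
      by (rule ssubst) simp
    then show False
      by simp
  qed
  have bounds: "2 * int_decode (word_value infinite_dihedral v) \<le> 2 * M + c * (int (length v) - 1)"
    if "v \<in> lists A" "odd (int_decode (word_value infinite_dihedral v))" for v
  proof -
    have "2 * \<bar>int_decode a\<bar> \<le> c" if "a \<in> A" "even (int_decode a)" for a
      using abs_le_\<tau>[OF that] by (simp add: c_def)
    moreover have "M - m \<le> c"
      by (simp add: c_def)
    ultimately show ?thesis
      using word_value_bounds[of v A c m M] that reflection by simp
  qed
  \<comment> \<open>Both three-letter words below have value M + c. It is odd as \<open>c\<close> is
    even, so the bound for odd values gives 2c \<le> c(n - 1) for any word of length n with this
    value.\<close>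
  have min: "3 \<le> length v"
    if "v \<in> lists A" "int_decode (word_value infinite_dihedral v) = M + c" "even c" for v
  proof -
    have "c * 2 \<le> c * (int (length v) - 1)"
      using bounds[of v] that \<open>odd M\<close> by simp
    then show ?thesis
      using c by simp
  qed
  show ?thesis
  proof (cases "c = 2 * \<tau>")
    case True
    \<comment> \<open>As c > 0, \<tau> is not the inserted 0 and comes from a translation in
      \<open>A\<close>.\<close>
    with c \<open>\<tau> \<in> T\<close> obtain t where t: "t \<in> A" "int_decode t = \<tau>" "even \<tau>"
      by (auto simp: T_def)
    show ?thesis
    proof (rule not_piecewise_excluding_if_cancelling[OF A])
      show "[t, r, inv\<^bsub>infinite_dihedral\<^esub> t] \<in> lists A"
        using t r inv by simp
      show "3 \<le> length v" if "v \<in> lists A" and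
        "word_value infinite_dihedral v =
         word_value infinite_dihedral [t, r, inv\<^bsub>infinite_dihedral\<^esub> t]" for v
        using that t r True by (intro min) (auto simp: dihedral_mult_def)
    qed simp
  next
    case False
    then have c_eq: "c = M - m"
      by (auto simp: c_def max_def split: if_splits)
    show ?thesis
    proof (rule not_piecewise_excluding_if_cancelling[OF A])
      show "[r, s, r] \<in> lists A"
        using r s by simp
      show "r \<otimes>\<^bsub>infinite_dihedral\<^esub> r = \<one>\<^bsub>infinite_dihedral\<^esub>"
        using r by (simp add: decode_eq_iff dihedral_mult_def)
      show "3 \<le> length v" if "v \<in> lists A" and
        "word_value infinite_dihedral v = word_value infinite_dihedral [r, s, r]" for v
        \<comment> \<open>The value is M - (m - M) = M + c, and \<open>c\<close> is even as a
          difference of odd numbers.\<close>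
        using that r s c_eq by (intro min) (auto simp: dihedral_mult_def)
    qed
  qed
qed

theorem corollary3p10:
  shows "\<exists>G :: nat monoid.
           group G \<and> finitely_generated_group G \<and> virtually_abelian G \<and>
           (\<forall>A. finite A \<and> symmetric_generating_set G A
                  \<longrightarrow> \<not> piecewise_excluding A (Geo G A))"
  using group_infinite_dihedral finitely_generated_infinite_dihedral
    virtually_abelian_infinite_dihedral Geo_infinite_dihedral_not_piecewise_excluding
  by blast

end
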